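(* Let $G$ be a finite connected graph with radius $r$ and diameter $d$, where $d\leq 2r-2$. Then $c(G)\geq 4r-2d$; that is, $G$ contains a cycle of length at least $4r-2d$.
   Context: Graphs are finite, simple and undirected. For a connected graph $G$, $d(u,v)$ is the length of a shortest $u$–$v$ path. The eccentricity of a vertex $u$ is $e(u)=\max\{d(u,v): v\in V(G)\}$. The radius of $G$ is the minimum eccentricity over all vertices. The diameter of $G$ is the maximum eccentricity over all vertices. The circumference $c(G)$ is the length of a longest cycle in $G$. *)

theory Defs
  imports "Graph_Theory.Graph_Theory"
begin

text \<open>
  A finite simple undirected graph is an instance of the locale \<^locale>\<open>graph\<close>: a finite
  digraph without loops and parallel arcs whose adjacency relation is symmetric, so that an
  edge is represented by a pair of opposite arcs.
\<close>

context pre_digraph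
begin

definition distance :: "'a \<Rightarrow> 'a \<Rightarrow> nat" where
  "distance u v = (LEAST n. \<exists>p. apath u p v \<and> length p = n)"

definition eccentricity :: "'a \<Rightarrow> nat" where
  "eccentricity u = Max {distance u v | v. v \<in> verts G}"

definition radius :: nat where
  "radius = Min {eccentricity u | u. u \<in> verts G}"

definition diameter :: nat where
  "diameter = Max {eccentricity u | u. u \<in> verts G}"

text \<open>
  In a symmetric digraph the library's \<^const>\<open>cycle\<close> also admits the closed walk of length 2
  that traverses an edge back and forth. It is not a cycle of the undirected graph, hence the
  bound on the length.
\<close>

definition undirected_cycle :: "'b awalk \<Rightarrow> bool" where
  "undirected_cycle p \<longleftrightarrow> cycle p \<and> 3 \<le> length p"

text \<open>Meaningful only for graphs that contain a cycle: the maximum of the empty set is unspecified.\<close>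

definition circumference :: nat where
  "circumference = Max {length p | p. undirected_cycle p}"

end

end

theory Submission
  imports Defs
begin

text \<open>
  Call a vertex \<open>c\<close> a separator of \<open>u\<close> and \<open>v\<close> if it lies on every walk from \<open>u\<close> to \<open>v\<close>, and let
  \<open>u\<close>, \<open>v\<close> be at distance \<open>d\<close>. A separator \<open>a\<close> of \<open>u\<close> and \<open>v\<close> separates each vertex \<open>z\<close> from \<open>u\<close> or
  from \<open>v\<close>, so the eccentricity of \<open>a\<close> is at most the maximum of \<open>d(u,a)\<close> and \<open>d - d(u,a)\<close>. Hence
  either \<open>d(u,a) \<le> d - r\<close> (``low'', for example \<open>u\<close>) or \<open>d(u,a) \<ge> r\<close> (``high'', for example \<open>v\<close>).
  Choose a low \<open>a\<close> and a high \<open>b\<close> at minimal distance from each other; this distance is at least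
  \<open>2r - d \<ge> 2\<close>. By minimality no third vertex separates \<open>a\<close> from \<open>b\<close>, so by the two-path case of Menger's
  theorem there is a cycle through \<open>a\<close> and \<open>b\<close>, and its length is at least \<open>2(2r - d)\<close>.
\<close>

section \<open>Vertex walks and separators\<close>

text \<open>Walks are nonempty vertex lists over a bare relation, so Menger's theorem becomes an
  induction on lists. The list \<open>[u]\<close> is a walk for every \<open>u\<close>, in the graph
  or not; hence the later hypotheses \<open>u \<in> verts G\<close>.\<close>

definition walk_betw :: "('a \<Rightarrow> 'a \<Rightarrow> bool) \<Rightarrow> 'a \<Rightarrow> 'a list \<Rightarrow> 'a \<Rightarrow> bool" where
  "walk_betw E u xs v \<longleftrightarrow> xs \<noteq> [] \<and> hd xs = u \<and> last xs = v \<and> successively E xs"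

text \<open>Both end points always belong to this set. If no walk exists, everything does.\<close>

definition separators :: "('a \<Rightarrow> 'a \<Rightarrow> bool) \<Rightarrow> 'a \<Rightarrow> 'a \<Rightarrow> 'a set" where
  "separators E u v = {c. \<forall>xs. walk_betw E u xs v \<longrightarrow> c \<in> set xs}"

lemma walk_betw_ends:
  assumes "walk_betw E u xs v"
  shows "u \<in> set xs" "v \<in> set xs"
  using assms by (auto simp: walk_betw_def)

lemma walk_betw_rev:
  assumes "symp E" "walk_betw E u xs v"
  shows "walk_betw E v (rev xs) u"
proof -
  have "(\<lambda>x y. E y x) = E" using assms(1) by (auto simp: symp_def fun_eq_iff)
  then have "successively E (rev xs) = successively E xs" by (simp only: successively_rev)
  then show ?thesis using assms(2) by (auto simp: walk_betw_def hd_rev last_rev)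
qed

lemma walk_betw_append:
  assumes "walk_betw E u xs v" "walk_betw E v ys w"
  shows "walk_betw E u (xs @ tl ys) w"
proof -
  obtain ys' where ys: "ys = v # ys'" using assms(2) by (cases ys) (auto simp: walk_betw_def)
  have "last xs = v" "xs \<noteq> []" using assms(1) by (auto simp: walk_betw_def)
  then show ?thesis
    using assms by (cases ys') (auto simp: ys walk_betw_def successively_append_iff)
qed

lemma walk_betw_split:
  assumes "walk_betw E u (xs @ c # ys) v"
  shows "walk_betw E u (xs @ [c]) c" "walk_betw E c (c # ys) v"
  using assms by (auto simp: walk_betw_def successively_append_iff hd_append)

lemma walk_betw_snoc:
  assumes "walk_betw E u xs v" "E v w"
  shows "walk_betw E u (xs @ [w]) w"
  using assms by (auto simp: walk_betw_def successively_append_iff)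

lemma walk_betw_butlast:
  assumes "walk_betw E u (xs @ [v]) v" "xs \<noteq> []"
  shows "walk_betw E u xs (last xs)" "E (last xs) v"
  using assms by (auto simp: walk_betw_def successively_append_iff)

lemma walk_betw_distinct:
  assumes "walk_betw E u xs v"
  obtains ys where "walk_betw E u ys v" "distinct ys" "set ys \<subseteq> set xs"
proof -
  have "\<exists>ys. walk_betw E u ys v \<and> distinct ys \<and> set ys \<subseteq> set xs"
    using assms
  proof (induction xs arbitrary: u)
    case Nil
    then show ?case by (simp add: walk_betw_def)
  next
    case (Cons a xs)
    show ?case
    proof (cases "xs = []")
      case True
      with Cons.prems show ?thesis by (intro exI[of _ "[a]"]) auto
    next
      case False
      have ua: "u = a" using Cons.prems by (simp add: walk_betw_def)
      have "E a (hd xs)" "walk_betw E (hd xs) xs v"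
        using Cons.prems False by (auto simp: walk_betw_def successively_Cons)
      with Cons.IH obtain ys where ys: "walk_betw E (hd xs) ys v" "distinct ys" "set ys \<subseteq> set xs"
        by blast
      \<comment> \<open>If \<open>a\<close> recurs in the simple walk \<open>ys\<close>, the loop is
        cut out by starting at that occurrence.\<close>
      show ?thesis
      proof (cases "a \<in> set ys")
        case True
        then obtain ys1 ys2 where "ys = ys1 @ a # ys2" by (meson split_list)
        with ys show ?thesis
          using walk_betw_split(2)[of E "hd xs" ys1 a ys2 v] ua by (intro exI[of _ "a # ys2"]) auto
      next
        case False
        with ys ua \<open>E a (hd xs)\<close> show ?thesis
          by (intro exI[of _ "a # ys"]) (auto simp: walk_betw_def successively_Cons)
      qed
    qed
  qed
  then show ?thesis using that by blast
qed

lemma separators_ends: "u \<in> separators E u v" "v \<in> separators E u v"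
  by (auto simp: separators_def walk_betw_def)

lemma separators_sym:
  assumes "symp E"
  shows "separators E u v = separators E v u"
  using walk_betw_rev[OF assms] unfolding separators_def by (metis set_rev)

text \<open>Otherwise walks from \<open>z\<close> to \<open>u\<close> and to \<open>v\<close> that
  avoid \<open>c\<close> could be joined at \<open>z\<close> to a walk from \<open>u\<close> to
  \<open>v\<close> that avoids \<open>c\<close>.\<close>

lemma separators_trans:
  assumes "symp E" "c \<in> separators E u v"
  shows "c \<in> separators E z u \<or> c \<in> separators E z v"
proof (rule ccontr)
  assume "\<not> ?thesis"
  then obtain xs ys where xs: "walk_betw E z xs u" "c \<notin> set xs"
    and ys: "walk_betw E z ys v" "c \<notin> set ys"
    by (auto simp: separators_def)
  have "walk_betw E u (rev xs @ tl ys) v"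
    using walk_betw_append[OF walk_betw_rev[OF assms(1) xs(1)] ys(1)] .
  moreover have "c \<notin> set (rev xs @ tl ys)" using xs ys by (cases ys) auto
  ultimately show False using assms(2) by (auto simp: separators_def)
qed

text \<open>Every walk from \<open>u\<close> to \<open>v\<close> meets both \<open>a\<close> and
  \<open>b\<close>, so it contains a walk between them, in one direction or the other. By symmetry
  either direction forces \<open>c\<close> onto it.\<close>

lemma separators_mono:
  assumes "symp E" "a \<in> separators E u v" "b \<in> separators E u v" "c \<in> separators E a b"
  shows "c \<in> separators E u v"
  unfolding separators_def
proof (intro CollectI allI impI)
  fix xs assume xs: "walk_betw E u xs v"
  with assms have "a \<in> set xs" "b \<in> set xs" by (auto simp: separators_def)
  then obtain xs1 xs2 where split: "xs = xs1 @ a # xs2" by (meson split_list)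
  have "\<exists>ys. (walk_betw E a ys b \<or> walk_betw E b ys a) \<and> set ys \<subseteq> set xs"
  proof (cases "b \<in> set (a # xs2)")
    case True
    then obtain ys1 ys2 where ys: "a # xs2 = ys1 @ b # ys2" by (meson split_list)
    then have "walk_betw E a (ys1 @ [b]) b" using xs split walk_betw_split by metis
    moreover have "set (ys1 @ [b]) \<subseteq> set (a # xs2)" unfolding ys by auto
    ultimately show ?thesis using split by (intro exI[of _ "ys1 @ [b]"]) auto
  next
    case False
    with \<open>b \<in> set xs\<close> split have "b \<in> set xs1" by auto
    then obtain ys1 ys2 where ys: "xs1 = ys1 @ b # ys2" by (meson split_list)
    have "walk_betw E u ((ys1 @ b # ys2) @ [a]) a"
      using xs walk_betw_split(1) unfolding split ys by metis
    then have "walk_betw E b (b # ys2 @ [a]) a" using walk_betw_split(2) by fastforce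
    then show ?thesis using split ys by (intro exI[of _ "b # ys2 @ [a]"]) auto
  qed
  moreover have "c \<in> separators E b a" using assms separators_sym by metis
  ultimately show "c \<in> set xs" using assms(4) by (auto simp: separators_def)
qed

section \<open>Menger's theorem for two paths\<close>

text \<open>Internally disjoint paths. Paths without interior, such as a single edge, may coincide;
  a cycle arises only once lengths are bounded below.\<close>

definition disjoint_paths :: "('a \<Rightarrow> 'a \<Rightarrow> bool) \<Rightarrow> 'a \<Rightarrow> 'a \<Rightarrow> 'a list \<Rightarrow> 'a list \<Rightarrow> bool" where
  "disjoint_paths E x y P Q \<longleftrightarrow> walk_betw E x P y \<and> walk_betw E x Q y \<and> distinct P \<and> distinct Q
    \<and> set P \<inter> set Q \<subseteq> {x, y}"

lemma disjoint_paths_sym: "disjoint_paths E x y P Q \<Longrightarrow> disjoint_paths E x y Q P"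
  by (auto simp: disjoint_paths_def)

text \<open>
  Here \<open>z # R2\<close> is the tail of a path to \<open>y\<close> that leaves the two given paths for the last time at
  \<open>z\<close>. The first path is rerouted along it, the second one is extended by the edge from \<open>w\<close> to \<open>y\<close>.
\<close>

lemma disjoint_paths_reroute:
  assumes PQ: "disjoint_paths E x w P Q" and "E w y" "y \<noteq> w" "y \<noteq> x"
    and z: "z \<in> set P" "z \<noteq> w"
    and R: "walk_betw E z (z # R2) y" "distinct R2" "set R2 \<inter> (set P \<union> set Q) = {}"
  shows "\<exists>P' Q'. disjoint_paths E x y P' Q'"
proof -
  have P: "walk_betw E x P w" "distinct P" and Q: "walk_betw E x Q w" "distinct Q"
    and disj: "set P \<inter> set Q \<subseteq> {x, w}"
    using PQ by (simp_all add: disjoint_paths_def)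
  obtain P1 P2 where P12: "P = P1 @ z # P2" using z(1) by (meson split_list)
  have "last (z # P2) = w" using P(1) by (simp add: P12 walk_betw_def)
  then have w: "w \<in> set P2" using z(2) last_in_set[of P2] by (cases "P2 = []") simp_all
  have y: "y \<notin> set Q"
  proof (cases "R2 = []")
    case True
    then have "y = z" using R(1) by (simp add: walk_betw_def)
    then show ?thesis using z disj assms(3,4) by blast
  next
    case False
    then have "y \<in> set R2" using R(1) last_in_set[of R2] by (simp add: walk_betw_def)
    then show ?thesis using R(3) by blast
  qed
  have "walk_betw E x (P1 @ z # R2) y"
    using walk_betw_append[OF walk_betw_split(1)[OF P(1)[unfolded P12]] R(1)] by simp
  moreover have "walk_betw E x (Q @ [y]) y" using Q(1) assms(2) by (rule walk_betw_snoc)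
  moreover have "distinct (P1 @ z # R2)" "distinct (Q @ [y])"
    using P(2) P12 Q(2) R(2,3) y by auto
  moreover have "set (P1 @ z # R2) \<inter> set (Q @ [y]) \<subseteq> {x, y}"
  proof -
    \<comment> \<open>\<open>w\<close> lies beyond \<open>z\<close> on \<open>P\<close>, so the part
      of \<open>P\<close> that is kept meets \<open>Q\<close> in \<open>x\<close> only.\<close>
    have "w \<notin> set P1" using P(2) w by (auto simp: P12)
    then show ?thesis using disj R(3) z(2) by (auto simp: P12)
  qed
  ultimately show ?thesis unfolding disjoint_paths_def by blast
qed

text \<open>A path to \<open>y\<close> avoiding \<open>w\<close> starts at \<open>x\<close>, hence
  on both given paths. Its last vertex \<open>z\<close> on their union is the place to reroute, and
  \<open>z \<noteq> w\<close>. The roles of \<open>P\<close> and \<open>Q\<close> are swapped if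
  \<open>z\<close> lies on \<open>Q\<close>.\<close>

lemma disjoint_paths_step:
  assumes PQ: "disjoint_paths E x w P Q" and y: "E w y" "y \<noteq> w" "y \<noteq> x"
    and R: "walk_betw E x R y" "w \<notin> set R"
  shows "\<exists>P' Q'. disjoint_paths E x y P' Q'"
proof -
  obtain R' where R': "walk_betw E x R' y" "distinct R'" "w \<notin> set R'"
    using walk_betw_distinct[OF R(1)] R(2) by (metis subsetD)
  have "x \<in> set R'" "x \<in> set P"
    using R'(1) PQ walk_betw_ends(1) unfolding disjoint_paths_def by metis+
  then have "\<exists>z \<in> set R'. z \<in> set P \<union> set Q" by auto
  then obtain R1 z R2 where split: "R' = R1 @ z # R2" and z: "z \<in> set P \<union> set Q"
    and R2: "\<forall>r \<in> set R2. r \<notin> set P \<union> set Q"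
    by (rule split_list_last_propE) blast
  have "walk_betw E z (z # R2) y" "distinct R2" "z \<noteq> w"
    using R' walk_betw_split(2) unfolding split by (metis, auto)
  moreover have "set R2 \<inter> (set P \<union> set Q) = {}" "set R2 \<inter> (set Q \<union> set P) = {}"
    using R2 by blast+
  ultimately show ?thesis
    using z disjoint_paths_reroute[OF PQ y] disjoint_paths_reroute[OF disjoint_paths_sym[OF PQ] y]
    by blast
qed

text \<open>Induction along a path, from the penultimate vertex \<open>w\<close> to
  \<open>y\<close>. The separator hypothesis passes to \<open>w\<close>: a walk to \<open>y\<close>
  avoiding \<open>c\<close>, extended by the edge back to \<open>w\<close>, still avoids
  \<open>c\<close>.\<close>

lemma menger_two_paths:
  assumes "symp E" "walk_betw E x xs y" "distinct xs" "separators E x y \<subseteq> {x, y}"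
  shows "\<exists>P Q. disjoint_paths E x y P Q"
  using assms(2-)
proof (induction xs arbitrary: y rule: rev_induct)
  case Nil
  then show ?case by (simp add: walk_betw_def)
next
  case (snoc y' ws)
  have y': "y' = y" using snoc.prems by (simp add: walk_betw_def)
  show ?case
  proof (cases "ws = []")
    case True
    then have "disjoint_paths E x y [x] [x]"
      using snoc.prems(1) by (auto simp: disjoint_paths_def walk_betw_def)
    then show ?thesis by blast
  next
    case False
    define w where "w = last ws"
    have ws: "walk_betw E x ws w" "E w y"
      using walk_betw_butlast[of E x ws y] snoc.prems(1) False by (simp_all add: y' w_def)
    have ne: "y \<noteq> w" "y \<noteq> x" "y \<notin> set ws"
      using snoc.prems(2) False walk_betw_ends[OF ws(1)] by (auto simp: y')
    show ?thesis
    proof (cases "w = x")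
      case True
      then have "disjoint_paths E x y [x, y] [x, y]"
        using ws(2) ne(2) by (simp add: disjoint_paths_def walk_betw_def)
      then show ?thesis by blast
    next
      case False
      have "separators E x w \<subseteq> {x, w}"
      proof
        fix c assume c: "c \<in> separators E x w"
        show "c \<in> {x, w}"
        proof (rule ccontr)
          assume nc: "c \<notin> {x, w}"
          \<comment> \<open>The initial segment \<open>ws\<close> reaches \<open>w\<close> without
            visiting \<open>y\<close>.\<close>
          have "c \<noteq> y" using c ws(1) ne(3) by (auto simp: separators_def)
          with nc snoc.prems(3) obtain R where R: "walk_betw E x R y" "c \<notin> set R"
            by (auto simp: separators_def)
          have "walk_betw E x (R @ [w]) w"
            using R(1) ws(2) assms(1) by (auto intro: walk_betw_snoc dest: sympD)
          with c have "c \<in> set (R @ [w])" by (auto simp: separators_def)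
          with nc R(2) show False by auto
        qed
      qed
      then obtain P Q where PQ: "disjoint_paths E x w P Q"
        using snoc.IH[OF ws(1)] snoc.prems(2) by auto
      have "w \<notin> separators E x y" using snoc.prems(3) False ne by auto
      then obtain R where "walk_betw E x R y" "w \<notin> set R" by (auto simp: separators_def)
      then show ?thesis using disjoint_paths_step[OF PQ ws(2) ne(1,2)] by blast
    qed
  qed
qed

section \<open>Distances and cycles in connected graphs\<close>

context graph
begin

abbreviation adj :: "'a \<Rightarrow> 'a \<Rightarrow> bool" where
  "adj \<equiv> dominates G"

lemma symp_adj: "symp adj"
  using sym_arcs by (auto simp: symmetric_def sym_def symp_def)

lemma awalk_imp_walk_betw:
  assumes "awalk u p v"
  shows "walk_betw adj u (awalk_verts u p) v"
  using assms
proof (induction p arbitrary: u)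
  case Nil
  then show ?case by (simp add: walk_betw_def awalk_Nil_iff)
next
  case (Cons e p)
  then have "adj u (head G e)" "walk_betw adj (head G e) (awalk_verts (head G e) p) v"
    "tail G e = u"
    by (auto simp: awalk_Cons_iff dest: in_arcs_imp_in_arcs_ends)
  then show ?case by (auto simp: walk_betw_def successively_Cons)
qed

lemma walk_betw_imp_awalk:
  assumes "walk_betw adj u xs v" "u \<in> verts G"
  obtains p where "awalk u p v" "awalk_verts u p = xs"
proof -
  have "\<exists>p. awalk u p v \<and> awalk_verts u p = xs"
    using assms
  proof (induction xs arbitrary: u)
    case Nil
    then show ?case by (simp add: walk_betw_def)
  next
    case (Cons a xs)
    have a: "a = u" using Cons.prems by (simp add: walk_betw_def)
    show ?case
    proof (cases "xs = []")
      case True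
      then show ?thesis
        using Cons.prems by (intro exI[of _ "[]"]) (auto simp: walk_betw_def awalk_Nil_iff)
    next
      case False
      have adj: "adj a (hd xs)" and w: "walk_betw adj (hd xs) xs v"
        using Cons.prems False by (auto simp: walk_betw_def successively_Cons)
      from adj obtain e where e: "e \<in> arcs G" "tail G e = a" "head G e = hd xs"
        by (auto simp: arcs_ends_def arc_to_ends_def)
      then have "hd xs \<in> verts G" by (metis head_in_verts)
      with Cons.IH[OF w] obtain p where "awalk (hd xs) p v" "awalk_verts (hd xs) p = xs" by blast
      with e a show ?thesis by (intro exI[of _ "e # p"]) (auto simp: awalk_Cons_iff)
    qed
  qed
  then show ?thesis using that by blast
qed

text \<open>The list counts vertices and \<open>distance\<close> counts arcs, hence the strict
  inequality.\<close>

lemma distance_less_length: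
  assumes "u \<in> verts G" "walk_betw adj u xs v"
  shows "distance u v < length xs"
proof -
  obtain ys where ys: "walk_betw adj u ys v" "distinct ys" "set ys \<subseteq> set xs"
    using walk_betw_distinct[OF assms(2)] .
  have "length ys \<le> length xs"
    using ys by (metis card_length card_mono distinct_card List.finite_set le_trans)
  obtain p where p: "awalk u p v" "awalk_verts u p = ys"
    using walk_betw_imp_awalk[OF ys(1) assms(1)] .
  then have "apath u p v" using ys(2) by (simp add: apath_def)
  then have "distance u v \<le> length p"
    unfolding distance_def by (intro Least_le) auto
  moreover have "length ys = Suc (length p)" using p(2) length_awalk_verts by metis
  ultimately show ?thesis using \<open>length ys \<le> length xs\<close> by simp
qed

text \<open>This makes the \<open>Max\<close> in \<open>circumference\<close> an upper bound. A
  cycle repeats no arc, so its length is at most the number of arcs.\<close>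

lemma finite_undirected_cycles: "finite {p. undirected_cycle p}"
proof (rule finite_subset)
  show "{p. undirected_cycle p} \<subseteq> {p. set p \<subseteq> arcs G \<and> length p \<le> card (arcs G)}"
  proof clarify
    fix p assume "undirected_cycle p"
    then have "set p \<subseteq> arcs G" "distinct p"
      by (auto simp: undirected_cycle_def cycle_conv)
    then show "set p \<subseteq> arcs G \<and> length p \<le> card (arcs G)"
      by (metis card_mono distinct_card finite_arcs)
  qed
qed (simp add: finite_lists_length_le)

lemma disjoint_paths_imp_undirected_cycle:
  assumes PQ: "disjoint_paths adj a b P Q" and "a \<in> verts G" "a \<noteq> b"
    and len: "3 \<le> length P" "3 \<le> length Q"
  obtains p where "undirected_cycle p" "length p + 2 = length P + length Q"
proof -
  have P: "walk_betw adj a P b" and Q: "walk_betw adj b (rev Q) a"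
    using PQ symp_adj by (auto simp: disjoint_paths_def intro: walk_betw_rev)
  obtain p where p: "awalk a p a" "awalk_verts a p = P @ tl (rev Q)"
    using walk_betw_imp_awalk[OF walk_betw_append[OF P Q] assms(2)] .
  have "Suc (length p) = length (P @ tl (rev Q))" using p(2) length_awalk_verts by metis
  then have l: "length p + 2 = length P + length Q" using len by simp
  have "Q \<noteq> []" "P \<noteq> []" using len by auto
  obtain P' where P': "P = a # P'" using P \<open>P \<noteq> []\<close> by (cases P) (auto simp: walk_betw_def)
  obtain Q' where Q': "Q = Q' @ [b]"
    using PQ \<open>Q \<noteq> []\<close> by (cases Q rule: rev_cases) (auto simp: disjoint_paths_def walk_betw_def)
  \<comment> \<open>The walk goes out along \<open>P\<close> and back along \<open>Q\<close>.
    Without its first vertex it is \<open>P' @ rev Q'\<close>, where \<open>b\<close> occurs only in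
    \<open>P'\<close> and \<open>a\<close> only in \<open>Q'\<close>.\<close>
  have "distinct (tl (awalk_verts a p))"
    using PQ P' Q' by (auto simp: p(2) disjoint_paths_def)
  then have "undirected_cycle p"
    using p(1) l len by (auto simp: undirected_cycle_def cycle_def)
  then show ?thesis using l that by blast
qed

end

section \<open>The metric of a connected graph\<close>

locale connected_graph = graph +
  assumes connected: "Digraph_Component.connected G"
begin

lemma verts_nonempty: "verts G \<noteq> {}"
  using connected by (auto simp: connected_conv)

lemma obtain_shortest_path:
  assumes "u \<in> verts G" "v \<in> verts G"
  obtains xs where "walk_betw adj u xs v" "distinct xs" "length xs = Suc (distance u v)"
proof -
  have "u \<rightarrow>\<^sup>*\<^bsub>G\<^esub> v"
    using symmetric_connected_imp_strongly_connected[OF sym_arcs connected] assms by auto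
  \<comment> \<open>Connectivity ensures that the \<open>LEAST\<close> in \<open>distance\<close> is
    attained.\<close>
  then have "\<exists>n p. apath u p v \<and> length p = n" by (simp add: reachable_apath)
  then have "\<exists>p. apath u p v \<and> length p = distance u v"
    unfolding distance_def by (rule LeastI_ex)
  then obtain p where "awalk u p v" "distinct (awalk_verts u p)" "length p = distance u v"
    by (auto simp: apath_def)
  then show ?thesis by (intro that[OF awalk_imp_walk_betw]) (simp_all add: length_awalk_verts)
qed

lemma distance_sym:
  assumes "u \<in> verts G" "v \<in> verts G"
  shows "distance u v = distance v u"
proof -
  have "distance u v \<le> distance v u" if uv: "u \<in> verts G" "v \<in> verts G" for u v
  proof -
    obtain xs where "walk_betw adj v xs u" "length xs = Suc (distance v u)"
      using obtain_shortest_path[OF uv(2,1)] by blast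
    then show ?thesis
      using distance_less_length[OF uv(1) walk_betw_rev[OF symp_adj]] by fastforce
  qed
  then show ?thesis using assms by (metis antisym)
qed

lemma distance_triangle:
  assumes "u \<in> verts G" "v \<in> verts G" "w \<in> verts G"
  shows "distance u w \<le> distance u v + distance v w"
proof -
  obtain xs where xs: "walk_betw adj u xs v" "length xs = Suc (distance u v)"
    using obtain_shortest_path[OF assms(1,2)] by blast
  obtain ys where ys: "walk_betw adj v ys w" "length ys = Suc (distance v w)"
    using obtain_shortest_path[OF assms(2,3)] by blast
  show ?thesis
    using distance_less_length[OF assms(1) walk_betw_append[OF xs(1) ys(1)]] xs ys by simp
qed

lemma separators_subset_verts:
  assumes "u \<in> verts G" "v \<in> verts G"
  shows "separators adj u v \<subseteq> verts G"
proof
  fix c assume "c \<in> separators adj u v"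
  moreover obtain xs where xs: "walk_betw adj u xs v" using obtain_shortest_path[OF assms] by blast
  ultimately have "c \<in> set xs" by (auto simp: separators_def)
  moreover obtain p where "awalk u p v" "awalk_verts u p = xs"
    using walk_betw_imp_awalk[OF xs assms(1)] .
  ultimately show "c \<in> verts G" by auto
qed

text \<open>A shortest path passes through \<open>c\<close>, and its two pieces bound the two
  distances from above. The triangle inequality gives the other direction.\<close>

lemma distance_separator:
  assumes "u \<in> verts G" "v \<in> verts G" "c \<in> separators adj u v"
  shows "distance u v = distance u c + distance c v"
proof -
  have c: "c \<in> verts G" using assms separators_subset_verts by blast
  obtain xs where xs: "walk_betw adj u xs v" "length xs = Suc (distance u v)"
    using obtain_shortest_path[OF assms(1,2)] by blast
  then have "c \<in> set xs" using assms(3) by (auto simp: separators_def)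
  then obtain xs1 xs2 where split: "xs = xs1 @ c # xs2" by (meson split_list)
  then have "walk_betw adj u (xs1 @ [c]) c" "walk_betw adj c (c # xs2) v"
    using walk_betw_split xs(1) by metis+
  then have "distance u c < length (xs1 @ [c])" "distance c v < length (c # xs2)"
    using assms(1) c distance_less_length by blast+
  then show ?thesis using xs(2) split distance_triangle[OF assms(1) c assms(2)] by simp
qed

lemma distance_refl: "u \<in> verts G \<Longrightarrow> distance u u = 0"
  using distance_less_length[of u "[u]" u] by (simp add: walk_betw_def)

section \<open>Eccentricity, radius and diameter\<close>

lemma finite_eccentricities: "finite {eccentricity u | u. u \<in> verts G}"
  by (simp add: finite_verts setcompr_eq_image)

lemma distance_le_eccentricity:
  assumes "v \<in> verts G"
  shows "distance u v \<le> eccentricity u"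
  unfolding eccentricity_def
  using assms by (intro Max_ge) (auto simp: setcompr_eq_image)

lemma obtain_eccentric:
  obtains v where "v \<in> verts G" "distance u v = eccentricity u"
proof -
  have "eccentricity u \<in> {distance u v | v. v \<in> verts G}"
    unfolding eccentricity_def
    using verts_nonempty by (intro Max_in) (auto simp: setcompr_eq_image)
  then show ?thesis using that by auto
qed

lemma radius_le_eccentricity: "u \<in> verts G \<Longrightarrow> radius \<le> eccentricity u"
  unfolding radius_def using finite_eccentricities by (intro Min_le) auto

lemma distance_le_diameter:
  assumes "u \<in> verts G" "v \<in> verts G"
  shows "distance u v \<le> diameter"
proof -
  have "eccentricity u \<le> diameter"
    unfolding diameter_def using finite_eccentricities assms by (intro Max_ge) auto
  with distance_le_eccentricity[OF assms(2), of u] show ?thesis by simp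
qed

lemma obtain_diametral:
  obtains u v where "u \<in> verts G" "v \<in> verts G" "distance u v = diameter"
proof -
  have "diameter \<in> {eccentricity u | u. u \<in> verts G}"
    unfolding diameter_def using finite_eccentricities verts_nonempty by (intro Max_in) auto
  then obtain u where "u \<in> verts G" "diameter = eccentricity u" by auto
  then show ?thesis using obtain_eccentric[of u] that by metis
qed

section \<open>Separators of a diametral pair and the long cycle\<close>

lemma separator_of_diametral_pair:
  assumes uv: "u \<in> verts G" "v \<in> verts G" "distance u v = diameter"
    and a: "a \<in> separators adj u v"
  shows "distance u a + radius \<le> diameter \<or> radius \<le> distance u a"
proof -
  have aV: "a \<in> verts G" using separators_subset_verts uv a by blast
  obtain z where z: "z \<in> verts G" "distance a z = eccentricity a" using obtain_eccentric .
  have "radius \<le> distance a z" using z radius_le_eccentricity aV by simp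
  moreover have "distance a z = distance z a" "distance a u = distance u a"
    using distance_sym aV z uv by auto
  moreover have "distance u a + distance a v = diameter" using distance_separator uv a by simp
  moreover have "distance z u \<le> diameter" "distance z v \<le> diameter"
    using distance_le_diameter z uv by auto
  \<comment> \<open>Here \<open>z\<close> is farthest from \<open>a\<close>. Separation from
    \<open>u\<close> yields the first alternative, separation from \<open>v\<close> the
    second.\<close>
  moreover have "distance z u = distance z a + distance a u
      \<or> distance z v = distance z a + distance a v"
    using separators_trans[OF symp_adj a, of z] distance_separator z uv by blast
  ultimately show ?thesis by linarith
qed

lemma obtain_inseparable_pair:
  assumes rd: "diameter + 2 \<le> 2 * radius"
  obtains a b where "a \<in> verts G" "b \<in> verts G" "2 * radius \<le> diameter + distance a b"
    "separators adj a b \<subseteq> {a, b}"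
proof -
  obtain u v where uv: "u \<in> verts G" "v \<in> verts G" "distance u v = diameter"
    using obtain_diametral .
  define good where "good = (\<lambda>(a, b). a \<in> separators adj u v \<and> b \<in> separators adj u v
    \<and> distance u a + radius \<le> diameter \<and> radius \<le> distance u b)"
  \<comment> \<open>With \<open>distance u u = 0\<close> and \<open>distance u v = diameter\<close>,
    this makes \<open>(u, v)\<close> a good pair, so a closest one exists.\<close>
  have "radius \<le> diameter"
    using radius_le_eccentricity[OF uv(1)] obtain_eccentric[of u] distance_le_diameter uv(1)
    by (metis le_trans)
  then have "good (u, v)"
    using uv separators_ends by (auto simp: good_def distance_refl)
  then obtain ab where ab: "good ab"
    and min: "\<And>y. good y \<Longrightarrow> (case ab of (a, b) \<Rightarrow> distance a b) \<le> (case y of (a, b) \<Rightarrow> distance a b)"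
    using ex_has_least_nat[of good "(u, v)" "\<lambda>(a, b). distance a b"] by blast
  obtain a b where [simp]: "ab = (a, b)" by force
  have sep: "a \<in> separators adj u v" "b \<in> separators adj u v"
    and low: "distance u a + radius \<le> diameter" and high: "radius \<le> distance u b"
    using ab by (auto simp: good_def)
  have V: "a \<in> verts G" "b \<in> verts G" using sep separators_subset_verts uv by auto
  have far: "2 * radius \<le> diameter + distance a b"
    using distance_triangle[OF uv(1) V] low high by simp
  have "separators adj a b \<subseteq> {a, b}"
  proof
    fix c assume c: "c \<in> separators adj a b"
    show "c \<in> {a, b}"
    proof (rule ccontr)
      assume nc: "c \<notin> {a, b}"
      have cV: "c \<in> verts G" using c V separators_subset_verts by blast
      have pos: "0 < distance x y" if xy: "x \<in> verts G" "y \<in> verts G" "x \<noteq> y" for x y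
      proof (rule ccontr)
        assume "\<not> ?thesis"
        then obtain xs where "walk_betw adj x xs y" "length xs = Suc 0"
          using obtain_shortest_path[OF xy(1,2)] by auto
        then show False using xy(3) by (auto simp: walk_betw_def length_Suc_conv)
      qed
      have "distance a b = distance a c + distance c b" using distance_separator V c by blast
      moreover have "0 < distance a c" "0 < distance c b" using pos V cV nc by auto
      moreover have cuv: "c \<in> separators adj u v" using separators_mono[OF symp_adj sep c] .
      \<comment> \<open>A low \<open>c\<close> can replace \<open>a\<close>, a high \<open>c\<close>
        can replace \<open>b\<close>; either way the pair is strictly closer.\<close>
      moreover have "good (c, b) \<or> good (a, c)"
        using separator_of_diametral_pair[OF uv cuv] cuv sep low high by (auto simp: good_def)
      ultimately show False using min by fastforce
    qed
  qed
  with V far show ?thesis using that by blast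
qed

lemma obtain_long_cycle:
  assumes rd: "diameter + 2 \<le> 2 * radius"
  obtains p where "undirected_cycle p" "4 * radius \<le> length p + 2 * diameter"
proof -
  obtain a b where V: "a \<in> verts G" "b \<in> verts G"
    and far: "2 * radius \<le> diameter + distance a b"
    and sep: "separators adj a b \<subseteq> {a, b}"
    using obtain_inseparable_pair[OF rd] .
  obtain xs where "walk_betw adj a xs b" "distinct xs" using obtain_shortest_path[OF V] by blast
  then obtain P Q where PQ: "disjoint_paths adj a b P Q"
    using menger_two_paths[OF symp_adj _ _ sep] by blast
  then have len: "distance a b < length P" "distance a b < length Q"
    using distance_less_length V(1) by (auto simp: disjoint_paths_def)
  \<comment> \<open>\<open>far\<close> and \<open>rd\<close> give
    \<open>distance a b \<ge> 2\<close>. So \<open>a\<close> and \<open>b\<close> differ and both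
    paths have at least three vertices.\<close>
  have "a \<noteq> b" using far rd V distance_refl by fastforce
  then obtain p where "undirected_cycle p" "length p + 2 = length P + length Q"
    using disjoint_paths_imp_undirected_cycle[OF PQ V(1)] len far rd by auto
  \<comment> \<open>\<open>length p = length P + length Q - 2\<close> is at least
    \<open>2 * distance a b\<close>, hence at least
    \<open>2 * (2 * radius - diameter)\<close>.\<close>
  then show ?thesis using that len far by fastforce
qed

end

theorem theorem1:
  fixes G :: "('a, 'b) pre_digraph" and r d :: nat
  assumes "graph G"
    and "Digraph_Component.connected G"
    and "r = pre_digraph.radius G"
    and "d = pre_digraph.diameter G"
    and "int d \<le> 2 * int r - 2"
  shows "int (pre_digraph.circumference G) \<ge> 4 * int r - 2 * int d
    \<and> (\<exists>p. pre_digraph.undirected_cycle G p \<and> int (length p) \<ge> 4 * int r - 2 * int d)"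
proof -
  interpret graph G by fact
  interpret connected_graph G by unfold_locales fact
  have "diameter + 2 \<le> 2 * radius" using assms(3-5) by linarith
  then obtain p where p: "undirected_cycle p" "4 * radius \<le> length p + 2 * diameter"
    using obtain_long_cycle by blast
  \<comment> \<open>The cycle \<open>p\<close> also shows that the maximum is taken over a nonempty
    set.\<close>
  have "length p \<le> circumference"
    unfolding circumference_def
    using p(1) finite_undirected_cycles by (intro Max_ge) (auto simp: setcompr_eq_image)
  with p assms(3,4) show ?thesis by (auto intro!: exI[of _ p])
qed

end
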